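(* Let $n,r,\lambda$ be positive integers with $n\ge 2r\ge 2\lambda$. Then any simple partial $r\times r$ $\lambda$-Latin square on the symbol set $[r]$ can be extended to a simple $n\times n$ $\lambda$-Latin square.
   Context: $[m]=\{1,\dots,m\}$. A partial $r\times r$ $\lambda$-Latin square on $[r]$ is an $r\times r$ array in which each cell contains a multiset of at most $\lambda$ symbols from $[r]$ such that each symbol of $[r]$ occurs at most $\lambda$ times (with multiplicity) in each row and in each column. It is simple if no cell contains a repeated symbol. An $n\times n$ $\lambda$-Latin square is an $n\times n$ array in which each cell contains a multiset of exactly $\lambda$ symbols from $[n]$ such that each symbol of $[n]$ occurs at most $\lambda$ times in each row and in each column (and hence exactly $\lambda$ times in each row and column, and $\lambda n$ times in total). It is simple if no cell contains a repeated symbol. A partial $r\times r$ $\lambda$-Latin square $M$ is extended to an $n\times n$ $\lambda$-Latin square $N$ if for all $i,j\in[r]$ the multiset in cell $(i,j)$ of $M$ is contained in the multiset in cell $(i,j)$ of $N$. *)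

theory Defs
  imports Main "HOL-Library.Multiset"
begin

text \<open>
  An \<open>m \<times> m\<close> array of multisets is a function of the row and column index, of which only the
  cells \<open>(i, j)\<close> with \<open>i, j \<in> {1..m}\<close> are relevant; values outside this range are ignored.
  The parameter \<open>l\<close> stands for the multiplicity usually written as the Greek letter lambda.
\<close>

type_synonym mset_array = "nat \<Rightarrow> nat \<Rightarrow> nat multiset"

definition row_col_bounded :: "nat \<Rightarrow> nat \<Rightarrow> mset_array \<Rightarrow> bool" where
  "row_col_bounded l m A \<longleftrightarrow>
     (\<forall>k\<in>{1..m}. \<forall>i\<in>{1..m}. (\<Sum>j\<in>{1..m}. count (A i j) k) \<le> l) \<and>
     (\<forall>k\<in>{1..m}. \<forall>j\<in>{1..m}. (\<Sum>i\<in>{1..m}. count (A i j) k) \<le> l)"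

definition partial_latin_square :: "nat \<Rightarrow> nat \<Rightarrow> mset_array \<Rightarrow> bool" where
  "partial_latin_square l r M \<longleftrightarrow>
     (\<forall>i\<in>{1..r}. \<forall>j\<in>{1..r}. set_mset (M i j) \<subseteq> {1..r} \<and> size (M i j) \<le> l) \<and>
     row_col_bounded l r M"

definition latin_square :: "nat \<Rightarrow> nat \<Rightarrow> mset_array \<Rightarrow> bool" where
  "latin_square l n N \<longleftrightarrow>
     (\<forall>i\<in>{1..n}. \<forall>j\<in>{1..n}. set_mset (N i j) \<subseteq> {1..n} \<and> size (N i j) = l) \<and>
     row_col_bounded l n N"

definition simple_array :: "nat \<Rightarrow> mset_array \<Rightarrow> bool" where
  "simple_array m A \<longleftrightarrow> (\<forall>i\<in>{1..m}. \<forall>j\<in>{1..m}. \<forall>k. count (A i j) k \<le> 1)"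

definition extended_to :: "nat \<Rightarrow> mset_array \<Rightarrow> mset_array \<Rightarrow> bool" where
  "extended_to r M N \<longleftrightarrow> (\<forall>i\<in>{1..r}. \<forall>j\<in>{1..r}. M i j \<subseteq># N i j)"

end

theory Submission
  imports Defs
begin

text \<open>
  A simple array is the same as a zero-one array \<open>T i j k\<close>, where \<open>T i j k = 1\<close> means that cell
  \<open>(i, j)\<close> contains the symbol \<open>k\<close>. Rows, columns and symbols then play symmetric roles: a partial
  square has all line sums at most \<open>l\<close>, and the goal is an \<open>n \<times> n \<times> n\<close> array with all line sums \<open>l\<close>
  that dominates the given \<open>r \<times> r \<times> r\<close> array. The array is enlarged in one direction at a time, by the
  \<open>n - r\<close> new symbols, then the \<open>n - r\<close> new columns, then the \<open>n - r\<close> new rows. Each enlargement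
  completes all lines in its direction and keeps the other line sums bounded by \<open>l\<close>.

  A single enlargement (lemma \<open>fill_lines\<close>) is a balanced edge colouring in the sense of de Werra. The
  deficits of the lines form a matrix \<open>b\<close>, read as a bipartite multigraph whose edges are to be
  coloured with the \<open>n - r\<close> new indices so that parallel edges get distinct colours and each colour
  occurs at most \<open>l\<close> times at each vertex. By lemma \<open>balanced_colouring\<close> this is possible as soon as
  \<open>b\<close> has entries at most \<open>n - r\<close> and line sums at most \<open>l * (n - r)\<close>. The entries are at most
  \<open>l \<le> r \<le> n - r\<close>. A line of \<open>b\<close> with \<open>r\<close> entries has sum at most \<open>l * r \<le> l * (n - r)\<close>, and a line
  with \<open>n\<close> entries has sum exactly \<open>l * n - l * r\<close>, because the \<open>r\<close> old layers are already full
  in the relevant direction. This is where \<open>n \<ge> 2 * r\<close> and \<open>r \<ge> l\<close> enter.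

  Balanced colourings are obtained from proper edge colourings of bipartite multigraphs (lemma
  \<open>bipartite_edge_colouring\<close>) by splitting vertices, and these in turn from Hall's theorem.
\<close>

section \<open>Edge colourings of bipartite multigraphs\<close>

text \<open>
  The induction of Halmos and Vaughan. If some nonempty proper \<open>J\<close> is critical, meaning that it has
  exactly \<open>card J\<close> candidates, these candidates are consumed by \<open>J\<close> and the Hall condition survives
  for \<open>I - J\<close> once they are removed. If no such \<open>J\<close> exists, every subset has a spare candidate, so
  that an arbitrary choice for one index does no harm.
\<close>

lemma hall_distinct_representatives:
  assumes "finite I" and "\<And>i. i \<in> I \<Longrightarrow> finite (S i)"
    and "\<And>J. J \<subseteq> I \<Longrightarrow> card J \<le> card (\<Union>(S ` J))"
  shows "\<exists>f. inj_on f I \<and> (\<forall>i\<in>I. f i \<in> S i)"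
  using assms
proof (induction I arbitrary: S rule: finite_psubset_induct)
  case (psubset I)
  note fin = \<open>finite I\<close> and finS = psubset.prems(1) and H = psubset.prems(2)
  have finU: "finite (\<Union>(S ` J))" if "J \<subseteq> I" for J
    using that finS fin by (auto intro: finite_subset)
  show ?case
  proof (cases "\<exists>J. J \<subset> I \<and> J \<noteq> {} \<and> card (\<Union>(S ` J)) = card J")
    case True
    then obtain J where J: "J \<subset> I" "J \<noteq> {}" "card (\<Union>(S ` J)) = card J"
      by blast
    let ?U = "\<Union>(S ` J)"
    have "\<exists>f. inj_on f J \<and> (\<forall>i\<in>J. f i \<in> S i)"
    proof (rule psubset.IH[OF J(1)])
      show "finite (S i)" if "i \<in> J" for i using that J finS by blast
      show "card L \<le> card (\<Union>(S ` L))" if "L \<subseteq> J" for L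
        using that J H[of L] by blast
    qed
    then obtain f where f: "inj_on f J" "\<And>i. i \<in> J \<Longrightarrow> f i \<in> S i" by blast
    have "\<exists>g. inj_on g (I - J) \<and> (\<forall>i\<in>I - J. g i \<in> S i - ?U)"
    proof (rule psubset.IH)
      show "I - J \<subset> I" using J by blast
      show "finite (S i - ?U)" if "i \<in> I - J" for i using that finS by blast
      show "card L \<le> card (\<Union>i\<in>L. S i - ?U)" if L: "L \<subseteq> I - J" for L
      proof -
        have eq: "\<Union>(S ` (J \<union> L)) = ?U \<union> (\<Union>i\<in>L. S i - ?U)" by blast
        have "finite J" "finite L" using J L fin by (auto intro: finite_subset)
        then have "card J + card L = card (J \<union> L)"
          using L by (subst card_Un_disjoint) auto
        also have "\<dots> \<le> card (\<Union>(S ` (J \<union> L)))" using J L by (intro H) auto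
        also have "\<dots> \<le> card ?U + card (\<Union>i\<in>L. S i - ?U)"
          unfolding eq by (rule card_Un_le)
        finally show ?thesis using J(3) by simp
      qed
    qed
    then obtain g where g: "inj_on g (I - J)" "\<And>i. i \<in> I - J \<Longrightarrow> g i \<in> S i - ?U" by blast
    let ?h = "\<lambda>i. if i \<in> J then f i else g i"
    have "inj_on ?h I"
      unfolding inj_on_def using f g by (auto dest: inj_onD) metis+
    moreover have "?h i \<in> S i" if "i \<in> I" for i
      using that f(2)[of i] g(2)[of i] by auto
    ultimately show ?thesis by blast
  next
    case False
    show ?thesis
    proof (cases "I = {}")
      case True
      then show ?thesis by auto
    next
      case False
      then obtain i where i: "i \<in> I" by blast
      have "S i \<noteq> {}" using H[of "{i}"] i by auto
      then obtain x where x: "x \<in> S i" by blast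
      have "\<exists>g. inj_on g (I - {i}) \<and> (\<forall>j\<in>I - {i}. g j \<in> S j - {x})"
      proof (rule psubset.IH)
        show "I - {i} \<subset> I" using i by blast
        show "finite (S j - {x})" if "j \<in> I - {i}" for j using that finS by blast
        show "card L \<le> card (\<Union>j\<in>L. S j - {x})" if L: "L \<subseteq> I - {i}" for L
        proof (cases "L = {}")
          case False
          have "card L < card (\<Union>(S ` L))"
            using H[of L] \<open>\<not> (\<exists>J. J \<subset> I \<and> J \<noteq> {} \<and> card (\<Union>(S ` J)) = card J)\<close> L i False
            by (metis Diff_subset Diff_iff insertI1 order.not_eq_order_implies_strict psubsetI subset_trans subsetD)
          moreover have "card (\<Union>(S ` L)) - 1 \<le> card (\<Union>(S ` L) - {x})"
            by (metis card_Diff_singleton_if diff_le_self le_refl)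
          moreover have "(\<Union>j\<in>L. S j - {x}) = \<Union>(S ` L) - {x}" by blast
          ultimately show ?thesis by simp
        qed simp
      qed
      then obtain g where g: "inj_on g (I - {i})" "\<And>j. j \<in> I - {i} \<Longrightarrow> g j \<in> S j - {x}" by blast
      have "inj_on (g(i := x)) I"
        unfolding inj_on_def using g by (auto dest: inj_onD)
      moreover have "(g(i := x)) j \<in> S j" if "j \<in> I" for j
        using that g(2)[of j] x by auto
      ultimately show ?thesis by blast
    qed
  qed
qed

text \<open>
  A matrix \<open>w\<close> is read as a bipartite multigraph with \<open>w x y\<close> parallel edges between \<open>x\<close> and \<open>y\<close>.
  Hall's condition holds by counting edges: the \<open>t * card J\<close> edges at \<open>J\<close> all end in the
  neighbourhood of \<open>J\<close>, whose vertices meet only \<open>t\<close> edges each.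
\<close>

lemma regular_has_perfect_matching:
  fixes w :: "'a \<Rightarrow> 'b \<Rightarrow> nat"
  assumes fin: "finite X" "finite Y" and t: "t > 0"
    and row: "\<And>x. x \<in> X \<Longrightarrow> (\<Sum>y\<in>Y. w x y) = t"
    and col: "\<And>y. y \<in> Y \<Longrightarrow> (\<Sum>x\<in>X. w x y) = t"
  shows "\<exists>f. bij_betw f X Y \<and> (\<forall>x\<in>X. w x (f x) > 0)"
proof -
  let ?S = "\<lambda>x. {y \<in> Y. w x y > 0}"
  have "\<exists>f. inj_on f X \<and> (\<forall>x\<in>X. f x \<in> ?S x)"
  proof (rule hall_distinct_representatives)
    show "card J \<le> card (\<Union>(?S ` J))" if J: "J \<subseteq> X" for J
    proof -
      let ?N = "\<Union>(?S ` J)"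
      have "t * card J = (\<Sum>x\<in>J. \<Sum>y\<in>Y. w x y)" using row J by (simp add: subset_iff)
      also have "\<dots> = (\<Sum>x\<in>J. \<Sum>y\<in>?N. w x y)"
        using fin by (intro sum.cong refl sum.mono_neutral_right) auto
      also have "\<dots> = (\<Sum>y\<in>?N. \<Sum>x\<in>J. w x y)" by (rule sum.swap)
      also have "\<dots> \<le> (\<Sum>y\<in>?N. \<Sum>x\<in>X. w x y)"
        using fin J by (intro sum_mono sum_mono2) auto
      also have "\<dots> = t * card ?N" using col by simp
      finally show ?thesis using t by simp
    qed
  qed (use fin in auto)
  then obtain f where f: "inj_on f X" "\<And>x. x \<in> X \<Longrightarrow> f x \<in> ?S x" by blast
  have "t * card X = (\<Sum>x\<in>X. \<Sum>y\<in>Y. w x y)" using row by simp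
  also have "\<dots> = (\<Sum>y\<in>Y. \<Sum>x\<in>X. w x y)" by (rule sum.swap)
  also have "\<dots> = t * card Y" using col by simp
  finally have "card X = card Y" using t by simp
  then have "f ` X = Y"
    using f fin by (intro card_subset_eq) (auto simp: card_image)
  then show ?thesis using f by (auto simp: bij_betw_def)
qed

lemma regular_splits_into_perfect_matchings:
  fixes w :: "'a \<Rightarrow> 'b \<Rightarrow> nat"
  assumes fin: "finite X" "finite Y" and "finite C"
    and "\<And>x. x \<in> X \<Longrightarrow> (\<Sum>y\<in>Y. w x y) = card C"
    and "\<And>y. y \<in> Y \<Longrightarrow> (\<Sum>x\<in>X. w x y) = card C"
  shows "\<exists>F. (\<forall>c\<in>C. bij_betw (F c) X Y) \<and>
    (\<forall>x\<in>X. \<forall>y\<in>Y. card {c \<in> C. F c x = y} = w x y)"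
  using assms(3-)
proof (induction C arbitrary: w rule: finite_induct)
  case empty
  then show ?case using fin by auto
next
  case (insert d C)
  have "card (insert d C) > 0" using insert.hyps by simp
  then obtain f where f: "bij_betw f X Y" and pos: "\<And>x. x \<in> X \<Longrightarrow> w x (f x) > 0"
    using regular_has_perfect_matching[OF fin _ insert.prems] by blast
  \<comment> \<open>Removing one perfect matching leaves a multigraph that is regular of degree one less.\<close>
  let ?e = "\<lambda>x y. if f x = y then 1 else 0 :: nat"
  let ?v = "\<lambda>x y. w x y - ?e x y"
  have v: "w x y = ?v x y + ?e x y" if "x \<in> X" for x y
    using pos[OF that] by auto
  have row: "(\<Sum>y\<in>Y. ?v x y) = card C" if "x \<in> X" for x
  proof -
    have "(\<Sum>y\<in>Y. w x y) = (\<Sum>y\<in>Y. ?v x y) + (\<Sum>y\<in>Y. ?e x y)"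
      using v[OF that] by (subst sum.distrib[symmetric]) (rule sum.cong, auto)
    moreover have "(\<Sum>y\<in>Y. ?e x y) = 1"
      using fin f that by (auto simp: bij_betw_def)
    ultimately show ?thesis using insert.prems(1)[OF that] insert.hyps by simp
  qed
  have col: "(\<Sum>x\<in>X. ?v x y) = card C" if "y \<in> Y" for y
  proof -
    obtain x0 where x0: "x0 \<in> X" "f x0 = y"
      using f \<open>y \<in> Y\<close> unfolding bij_betw_def by blast
    have "(\<Sum>x\<in>X. w x y) = (\<Sum>x\<in>X. ?v x y) + (\<Sum>x\<in>X. ?e x y)"
      using v by (subst sum.distrib[symmetric]) (rule sum.cong, auto)
    moreover have "(\<Sum>x\<in>X. ?e x y) = (\<Sum>x\<in>X. if x = x0 then 1 else 0)"
      using x0 f by (intro sum.cong refl) (auto simp: bij_betw_def dest: inj_onD)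
    ultimately show ?thesis using insert.prems(2)[OF that] insert.hyps fin x0 by simp
  qed
  obtain F where F: "\<And>c. c \<in> C \<Longrightarrow> bij_betw (F c) X Y"
    and cnt: "\<And>x y. x \<in> X \<Longrightarrow> y \<in> Y \<Longrightarrow> card {c \<in> C. F c x = y} = ?v x y"
    using insert.IH[of ?v] row col by blast
  have "card {c \<in> insert d C. (F(d := f)) c x = y} = w x y" if "x \<in> X" "y \<in> Y" for x y
  proof -
    have "{c \<in> insert d C. (F(d := f)) c x = y} =
      {c \<in> C. F c x = y} \<union> (if f x = y then {d} else {})"
      using insert.hyps by auto
    then show ?thesis
      using cnt[OF that] v[OF that(1), of y] insert.hyps by (auto simp: card_insert_if)
  qed
  moreover have "bij_betw ((F(d := f)) c) X Y" if "c \<in> insert d C" for c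
    using that F f by auto
  ultimately show ?case by blast
qed

text \<open>
  Koenig's edge colouring theorem with the colour classes \<open>P c\<close>. The multigraph is made regular by
  adding a mirrored copy of itself and joining each vertex to its mirror image by as many edges as its
  degree falls short; the colouring of the regular multigraph is then restricted. The last two clauses
  record that a vertex of full degree meets every colour: no padding edge is attached to it.
\<close>

lemma bipartite_edge_colouring:
  fixes w :: "'a \<Rightarrow> 'b \<Rightarrow> nat"
  assumes fin: "finite X" "finite Y" "finite C"
    and row: "\<forall>x\<in>X. (\<Sum>y\<in>Y. w x y) \<le> card C"
    and col: "\<forall>y\<in>Y. (\<Sum>x\<in>X. w x y) \<le> card C"
  shows "\<exists>P. (\<forall>x\<in>X. \<forall>y\<in>Y. card {c \<in> C. P c x y} = w x y) \<and>
    (\<forall>c\<in>C. \<forall>x\<in>X. \<forall>y y'. P c x y \<longrightarrow> P c x y' \<longrightarrow> y = y') \<and>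
    (\<forall>c\<in>C. \<forall>x\<in>X. \<forall>x'\<in>X. \<forall>y. P c x y \<longrightarrow> P c x' y \<longrightarrow> x = x') \<and>
    (\<forall>c\<in>C. \<forall>x\<in>X. (\<Sum>y\<in>Y. w x y) = card C \<longrightarrow> (\<exists>y\<in>Y. P c x y)) \<and>
    (\<forall>c\<in>C. \<forall>y\<in>Y. (\<Sum>x\<in>X. w x y) = card C \<longrightarrow> (\<exists>x\<in>X. P c x y))"
proof -
  let ?t = "card C"
  define v :: "'a + 'b \<Rightarrow> 'b + 'a \<Rightarrow> nat" where
    "v p q = (case p of
        Inl x \<Rightarrow> (case q of Inl y \<Rightarrow> w x y
                        | Inr x' \<Rightarrow> if x' = x then ?t - (\<Sum>y\<in>Y. w x y) else 0)
      | Inr y \<Rightarrow> (case q of Inl y' \<Rightarrow> if y' = y then ?t - (\<Sum>x\<in>X. w x y) else 0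
                        | Inr x \<Rightarrow> w x y))" for p q
  have "\<exists>F. (\<forall>c\<in>C. bij_betw (F c) (X <+> Y) (Y <+> X)) \<and>
    (\<forall>p\<in>X <+> Y. \<forall>q\<in>Y <+> X. card {c \<in> C. F c p = q} = v p q)"
  proof (rule regular_splits_into_perfect_matchings)
    show "(\<Sum>q\<in>Y <+> X. v p q) = card C" if "p \<in> X <+> Y" for p
      using that fin row col by (auto simp: sum.Plus v_def)
    show "(\<Sum>p\<in>X <+> Y. v p q) = card C" if "q \<in> Y <+> X" for q
      using that fin row col by (auto simp: sum.Plus v_def)
  qed (use fin in auto)
  then obtain F where F: "\<And>c. c \<in> C \<Longrightarrow> bij_betw (F c) (X <+> Y) (Y <+> X)"
    and cnt: "\<And>p q. p \<in> X <+> Y \<Longrightarrow> q \<in> Y <+> X \<Longrightarrow> card {c \<in> C. F c p = q} = v p q"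
    by blast
  have pos: "v p q > 0" if "c \<in> C" "p \<in> X <+> Y" "q \<in> Y <+> X" "F c p = q" for c p q
  proof -
    have "{c \<in> C. F c p = q} \<noteq> {}" and "finite {c \<in> C. F c p = q}"
      using that fin(3) by auto
    then have "card {c \<in> C. F c p = q} > 0" by (simp add: card_gt_0_iff)
    then show ?thesis using cnt[OF that(2,3)] by simp
  qed
  show ?thesis
  proof (intro exI[of _ "\<lambda>c x y. F c (Inl x) = Inl y"] conjI ballI allI impI)
    show "card {c \<in> C. F c (Inl x) = Inl y} = w x y" if "x \<in> X" "y \<in> Y" for x y
      using cnt[of "Inl x" "Inl y"] that by (simp add: v_def InlI)
    show "y = y'" if "F c (Inl x) = Inl y" "F c (Inl x) = Inl y'" for c x y y'
      using that by simp
    show "x = x'" if "c \<in> C" "x \<in> X" "x' \<in> X" "F c (Inl x) = Inl y" "F c (Inl x') = Inl y"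
      for c x x' y
      using F[OF that(1)] that(2-) by (metis InlI Inl_inject bij_betw_def inj_onD)
    show "\<exists>y\<in>Y. F c (Inl x) = Inl y"
      if "c \<in> C" "x \<in> X" "(\<Sum>y\<in>Y. w x y) = card C" for c x
    proof -
      have "F c (Inl x) \<in> Y <+> X" using F[OF that(1)] that(2) by (auto simp: bij_betw_def)
      then show ?thesis using pos[of c "Inl x" "F c (Inl x)"] that
        by (auto simp: v_def InlI split: if_splits)
    qed
    show "\<exists>x\<in>X. F c (Inl x) = Inl y"
      if "c \<in> C" "y \<in> Y" "(\<Sum>x\<in>X. w x y) = card C" for c y
    proof -
      have "Inl y \<in> F c ` (X <+> Y)" using F[OF that(1)] that(2) by (auto simp: bij_betw_def)
      then obtain p where "p \<in> X <+> Y" "F c p = Inl y" by force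
      then show ?thesis using pos[of c p "Inl y"] that
        by (auto simp: v_def InlI split: if_splits)
    qed
  qed
qed

section \<open>Balanced colourings\<close>

lemma exists_subfunction_with_sum:
  fixes f :: "'a \<Rightarrow> nat"
  assumes "finite K" and "m \<le> (\<Sum>k\<in>K. f k)"
  shows "\<exists>g. (\<forall>k\<in>K. g k \<le> f k) \<and> (\<Sum>k\<in>K. g k) = m"
  using assms
proof (induction K arbitrary: m rule: finite_induct)
  case (insert a K)
  let ?h = "min m (f a)"
  have "m - ?h \<le> (\<Sum>k\<in>K. f k)" using insert by simp
  then obtain g where g: "\<And>k. k \<in> K \<Longrightarrow> g k \<le> f k" "(\<Sum>k\<in>K. g k) = m - ?h"
    using insert.IH by blast
  have "(\<Sum>k\<in>K. (g(a := ?h)) k) = (\<Sum>k\<in>K. g k)"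
    using insert.hyps by (intro sum.cong) auto
  then have "(\<Sum>k\<in>insert a K. (g(a := ?h)) k) = m" using insert.hyps g by simp
  moreover have "\<forall>k\<in>insert a K. (g(a := ?h)) k \<le> f k" using g by auto
  ultimately show ?case by blast
qed simp

text \<open>
  In graph terms, a vertex of degree at most \<open>l * t\<close> is split into \<open>l\<close> vertices of degree at most \<open>t\<close>:
  the part \<open>u s\<close> lists the edges that are handed to the \<open>s\<close>-th copy.
\<close>

lemma split_into_bounded_parts:
  fixes f :: "'a \<Rightarrow> nat"
  assumes "finite K" and "(\<Sum>k\<in>K. f k) \<le> l * t"
  shows "\<exists>u. (\<forall>k\<in>K. (\<Sum>s<l. u s k) = f k) \<and> (\<forall>s<l. (\<Sum>k\<in>K. u s k) \<le> t)"
  using assms(2)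
proof (induction l arbitrary: f)
  case 0
  then show ?case using assms(1) by simp
next
  case (Suc l)
  obtain g where g: "\<And>k. k \<in> K \<Longrightarrow> g k \<le> f k" "(\<Sum>k\<in>K. g k) = min t (\<Sum>k\<in>K. f k)"
    using exists_subfunction_with_sum[OF assms(1), of "min t (\<Sum>k\<in>K. f k)" f] by auto
  have "(\<Sum>k\<in>K. f k - g k) = (\<Sum>k\<in>K. f k) - (\<Sum>k\<in>K. g k)"
    using g(1) by (rule sum_subtractf_nat)
  also have "\<dots> \<le> l * t" using Suc.prems g(2) by auto
  finally obtain u where u: "\<And>k. k \<in> K \<Longrightarrow> (\<Sum>s<l. u s k) = f k - g k"
    "\<And>s. s < l \<Longrightarrow> (\<Sum>k\<in>K. u s k) \<le> t"
    using Suc.IH by blast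
  have "(\<Sum>s<Suc l. (u(l := g)) s k) = f k" if "k \<in> K" for k
    using u(1)[OF that] g(1)[OF that] by simp
  moreover have "(\<Sum>k\<in>K. (u(l := g)) s k) \<le> t" if "s < Suc l" for s
    using u(2)[of s] g(2) that by auto
  ultimately show ?case by blast
qed

text \<open>
  By hypothesis \<open>b\<close> is \<open>card C\<close> times a rational matrix with entries at most \<open>1\<close> and line sums at
  most \<open>l\<close>; the point is to replace the \<open>card C\<close> equal summands by integral ones. Colouring the
  multigraph \<open>b\<close> after splitting each vertex into \<open>l\<close> copies bounds the degrees within a colour,
  but parallel edges may be distributed over different copies and receive equal colours. Therefore
  the edges between \<open>i\<close> and \<open>k\<close> are routed through a path \<open>i - p - q - k\<close> with multiplicities
  \<open>b i k\<close>, \<open>card C - b i k\<close> and \<open>b i k\<close>. Both inner vertices have degree \<open>card C\<close>, hence meet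
  every colour exactly once. A colour is thus either absorbed by the middle edges, or it occurs
  once on the first and once on the last part of the path; the latter colours, of which there are
  \<open>b i k\<close>, are those assigned to \<open>(i, k)\<close>. Only the end vertices are split, and the parallel edges
  at an end vertex may go to different copies without harm.
\<close>

lemma balanced_colouring:
  fixes b :: "'a \<Rightarrow> 'b \<Rightarrow> nat"
  assumes fin: "finite I" "finite K" "finite C"
    and ent: "\<And>i k. i \<in> I \<Longrightarrow> k \<in> K \<Longrightarrow> b i k \<le> card C"
    and row: "\<And>i. i \<in> I \<Longrightarrow> (\<Sum>k\<in>K. b i k) \<le> l * card C"
    and col: "\<And>k. k \<in> K \<Longrightarrow> (\<Sum>i\<in>I. b i k) \<le> l * card C"
  obtains A :: "'c \<Rightarrow> 'a \<Rightarrow> 'b \<Rightarrow> nat" where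
    "\<And>c i k. A c i k \<le> 1"
    "\<And>i k. i \<in> I \<Longrightarrow> k \<in> K \<Longrightarrow> (\<Sum>c\<in>C. A c i k) = b i k"
    "\<And>c i. c \<in> C \<Longrightarrow> i \<in> I \<Longrightarrow> (\<Sum>k\<in>K. A c i k) \<le> l"
    "\<And>c k. c \<in> C \<Longrightarrow> k \<in> K \<Longrightarrow> (\<Sum>i\<in>I. A c i k) \<le> l"
proof -
  let ?t = "card C"
  have "\<exists>u. \<forall>i\<in>I. (\<forall>k\<in>K. (\<Sum>s<l. u i s k) = b i k) \<and> (\<forall>s<l. (\<Sum>k\<in>K. u i s k) \<le> ?t)"
    using split_into_bounded_parts[OF fin(2) row] by (intro bchoice) blast
  then obtain u where u: "\<And>i k. i \<in> I \<Longrightarrow> k \<in> K \<Longrightarrow> (\<Sum>s<l. u i s k) = b i k"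
    "\<And>i s. i \<in> I \<Longrightarrow> s < l \<Longrightarrow> (\<Sum>k\<in>K. u i s k) \<le> ?t"
    by blast
  have "\<exists>v. \<forall>k\<in>K. (\<forall>i\<in>I. (\<Sum>s<l. v k s i) = b i k) \<and> (\<forall>s<l. (\<Sum>i\<in>I. v k s i) \<le> ?t)"
    using split_into_bounded_parts[OF fin(1) col] by (intro bchoice) blast
  then obtain v where v: "\<And>i k. i \<in> I \<Longrightarrow> k \<in> K \<Longrightarrow> (\<Sum>s<l. v k s i) = b i k"
    "\<And>k s. k \<in> K \<Longrightarrow> s < l \<Longrightarrow> (\<Sum>i\<in>I. v k s i) \<le> ?t"
    by blast
  \<comment> \<open>One side holds the copies \<open>(i, s)\<close> and the inner vertices \<open>q\<close>, the other side holds the inner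
    vertices \<open>p\<close> and the copies \<open>(k, s)\<close>; both kinds of inner vertices are indexed by \<open>(i, k)\<close>.\<close>
  define X :: "('a \<times> nat + 'a \<times> 'b) set" where "X = (I \<times> {..<l}) <+> (I \<times> K)"
  define Y :: "('a \<times> 'b + 'b \<times> nat) set" where "Y = (I \<times> K) <+> (K \<times> {..<l})"
  define w :: "'a \<times> nat + 'a \<times> 'b \<Rightarrow> 'a \<times> 'b + 'b \<times> nat \<Rightarrow> nat" where
    "w x y = (case x of
        Inl (i, s) \<Rightarrow> (case y of Inl (i', k) \<Rightarrow> if i' = i then u i s k else 0 | Inr _ \<Rightarrow> 0)
      | Inr (i, k) \<Rightarrow> (case y of
            Inl (i', k') \<Rightarrow> if i' = i then if k' = k then ?t - b i k else 0 else 0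
          | Inr (k', s) \<Rightarrow> if k' = k then v k s i else 0))" for x y
  have finXY: "finite X" "finite Y" using fin by (auto simp: X_def Y_def)
  have if_sum: "(\<Sum>k\<in>K'. if P then g k else 0) = (if P then \<Sum>k\<in>K'. g k else 0)"
    for K' and P and g :: "'z \<Rightarrow> nat" by simp
  note sums = sum.Plus sum.cartesian_product[symmetric] if_sum
  have row_copy: "(\<Sum>y\<in>Y. w (Inl (i, s)) y) = (\<Sum>k\<in>K. u i s k)" if "i \<in> I" for i s
    using fin that by (simp add: Y_def w_def sums)
  have row_pair: "(\<Sum>y\<in>Y. w (Inr (i, k)) y) = ?t" if "i \<in> I" "k \<in> K" for i k
    using fin that v(1)[OF that] ent[OF that] by (simp add: Y_def w_def sums)
  have col_copy: "(\<Sum>x\<in>X. w x (Inr (k, s))) = (\<Sum>i\<in>I. v k s i)" if "k \<in> K" for k s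
    using fin that by (simp add: X_def w_def sums)
  have col_pair: "(\<Sum>x\<in>X. w x (Inl (i, k))) = ?t" if "i \<in> I" "k \<in> K" for i k
  proof -
    have "(\<Sum>x\<in>X. w x (Inl (i, k))) = (\<Sum>s<l. u i s k) + (?t - b i k)"
      using fin that by (simp add: X_def w_def sums)
    then show ?thesis using u(1)[OF that] ent[OF that] by simp
  qed
  have rowX: "\<forall>x\<in>X. (\<Sum>y\<in>Y. w x y) \<le> ?t"
    using u(2) row_copy row_pair unfolding X_def by auto
  have colY: "\<forall>y\<in>Y. (\<Sum>x\<in>X. w x y) \<le> ?t"
    using v(2) col_copy col_pair unfolding Y_def by auto
  obtain P where
    P: "\<forall>x\<in>X. \<forall>y\<in>Y. card {c \<in> C. P c x y} = w x y"
      "\<forall>c\<in>C. \<forall>x\<in>X. \<forall>y y'. P c x y \<longrightarrow> P c x y' \<longrightarrow> y = y'"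
      "\<forall>c\<in>C. \<forall>x\<in>X. \<forall>x'\<in>X. \<forall>y. P c x y \<longrightarrow> P c x' y \<longrightarrow> x = x'"
      "\<forall>c\<in>C. \<forall>x\<in>X. (\<Sum>y\<in>Y. w x y) = ?t \<longrightarrow> (\<exists>y\<in>Y. P c x y)"
      "\<forall>c\<in>C. \<forall>y\<in>Y. (\<Sum>x\<in>X. w x y) = ?t \<longrightarrow> (\<exists>x\<in>X. P c x y)"
    using bipartite_edge_colouring[OF finXY fin(3) rowX colY] by (elim exE conjE)
  note cnt = P(1)[rule_format] and right_unique = P(2)[rule_format]
    and left_unique = P(3)[rule_format] and full_row = P(4)[rule_format]
    and full_col = P(5)[rule_format]
  have pos: "w x y > 0" if "c \<in> C" "x \<in> X" "y \<in> Y" "P c x y" for c x y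
  proof -
    have "{c \<in> C. P c x y} \<noteq> {}" and "finite {c \<in> C. P c x y}" using that fin(3) by auto
    then have "card {c \<in> C. P c x y} > 0" by (simp add: card_gt_0_iff)
    then show ?thesis using cnt[OF that(2,3)] by simp
  qed
  let ?used = "\<lambda>c i k. \<not> P c (Inr (i, k)) (Inl (i, k))"
  have used_row: "\<exists>s<l. P c (Inl (i, s)) (Inl (i, k))"
    if c: "c \<in> C" and ik: "i \<in> I" "k \<in> K" and "?used c i k" for c i k
  proof -
    have Y: "Inl (i, k) \<in> Y" using ik by (simp add: Y_def InlI)
    obtain x where x: "x \<in> X" "P c x (Inl (i, k))" using full_col[OF c Y col_pair[OF ik]] by blast
    then show ?thesis using pos[OF c x(1) Y x(2)] that
      by (auto simp: X_def w_def split: if_splits)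
  qed
  have used_col: "\<exists>s<l. P c (Inr (i, k)) (Inr (k, s))"
    if c: "c \<in> C" and ik: "i \<in> I" "k \<in> K" and "?used c i k" for c i k
  proof -
    have X: "Inr (i, k) \<in> X" using ik by (simp add: X_def InrI)
    obtain y where y: "y \<in> Y" "P c (Inr (i, k)) y" using full_row[OF c X row_pair[OF ik]] by blast
    then show ?thesis using pos[OF c X y(1) y(2)] that
      by (auto simp: Y_def w_def split: if_splits)
  qed
  \<comment> \<open>Entries of one row and one colour use distinct copies of \<open>i\<close>, of which there are \<open>l\<close>.\<close>
  have row_le: "card {k \<in> K. ?used c i k} \<le> l" if c: "c \<in> C" and i: "i \<in> I" for c i
  proof -
    obtain f where f: "\<And>k. k \<in> K \<Longrightarrow> ?used c i k \<Longrightarrow> f k < l \<and> P c (Inl (i, f k)) (Inl (i, k))"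
      using used_row[OF c i] by metis
    have "inj_on f {k \<in> K. ?used c i k}"
    proof (rule inj_onI)
      fix k k' assume "k \<in> {k \<in> K. ?used c i k}" "k' \<in> {k \<in> K. ?used c i k}" "f k = f k'"
      then have "Inl (i, k) = (Inl (i, k') :: 'a \<times> 'b + 'b \<times> nat)"
        using f[of k] f[of k'] i by (intro right_unique[OF c, of "Inl (i, f k)"]) (auto simp: X_def)
      then show "k = k'" by simp
    qed
    moreover have "f ` {k \<in> K. ?used c i k} \<subseteq> {..<l}" using f by auto
    ultimately show ?thesis using card_inj_on_le[of f _ "{..<l}"] by simp
  qed
  have col_le: "card {i \<in> I. ?used c i k} \<le> l" if c: "c \<in> C" and k: "k \<in> K" for c k
  proof -
    obtain f where f: "\<And>i. i \<in> I \<Longrightarrow> ?used c i k \<Longrightarrow> f i < l \<and> P c (Inr (i, k)) (Inr (k, f i))"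
      using used_col[OF c _ k] by metis
    have "inj_on f {i \<in> I. ?used c i k}"
    proof (rule inj_onI)
      fix i i' assume "i \<in> {i \<in> I. ?used c i k}" "i' \<in> {i \<in> I. ?used c i k}" "f i = f i'"
      then have "Inr (i, k) = (Inr (i', k) :: 'a \<times> nat + 'a \<times> 'b)"
        using f[of i] f[of i'] k
        by (intro left_unique[OF c, of _ _ "Inr (k, f i)"]) (auto simp: X_def)
      then show "i = i'" by simp
    qed
    moreover have "f ` {i \<in> I. ?used c i k} \<subseteq> {..<l}" using f by auto
    ultimately show ?thesis using card_inj_on_le[of f _ "{..<l}"] by simp
  qed
  have total: "card {c \<in> C. ?used c i k} = b i k" if ik: "i \<in> I" "k \<in> K" for i k
  proof -
    have "card {c \<in> C. P c (Inr (i, k)) (Inl (i, k))} = ?t - b i k"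
      using ik by (subst cnt) (auto simp: X_def Y_def w_def)
    moreover have "{c \<in> C. ?used c i k} = C - {c \<in> C. P c (Inr (i, k)) (Inl (i, k))}" by blast
    ultimately show ?thesis using ent[OF ik] fin(3) by (simp add: card_Diff_subset)
  qed
  have count: "(\<Sum>z\<in>Z. of_bool (Q z)) = card {z \<in> Z. Q z}" if "finite Z" for Z and Q :: "'z \<Rightarrow> bool"
    using that by (simp add: Int_def)
  show ?thesis
  proof (rule that[of "\<lambda>c i k. of_bool (?used c i k)"])
    show "(\<Sum>c\<in>C. of_bool (?used c i k)) = b i k" if "i \<in> I" "k \<in> K" for i k
      unfolding count[OF fin(3)] by (rule total[OF that])
    show "(\<Sum>k\<in>K. of_bool (?used c i k)) \<le> l" if "c \<in> C" "i \<in> I" for c i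
      unfolding count[OF fin(2)] by (rule row_le[OF that])
    show "(\<Sum>i\<in>I. of_bool (?used c i k)) \<le> l" if "c \<in> C" "k \<in> K" for c k
      unfolding count[OF fin(1)] by (rule col_le[OF that])
  qed simp
qed

section \<open>Completing a three-dimensional zero-one array\<close>

text \<open>
  In a three-dimensional array, let \<open>d i k\<close> be the sum that the line \<open>(i, k)\<close> has reached so far. The
  deficits \<open>l - d i k\<close> are supplied by new layers indexed by \<open>C\<close>: a balanced colouring of the deficits
  completes every line to \<open>l\<close> while each new layer is a zero-one matrix with line sums at most \<open>l\<close>.
  If the deficits of row \<open>i\<close> add up to \<open>l * card C\<close>, there is no slack and row \<open>i\<close> of every new layer
  has sum exactly \<open>l\<close>.
\<close>

lemma fill_lines:
  fixes d :: "'a \<Rightarrow> 'b \<Rightarrow> nat"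
  assumes fin: "finite I" "finite K" "finite C"
    and l: "l \<le> card C"
    and d: "\<And>i k. i \<in> I \<Longrightarrow> k \<in> K \<Longrightarrow> d i k \<le> l"
    and row: "\<And>i. i \<in> I \<Longrightarrow> l * card K \<le> (\<Sum>k\<in>K. d i k) + l * card C"
    and col: "\<And>k. k \<in> K \<Longrightarrow> l * card I \<le> (\<Sum>i\<in>I. d i k) + l * card C"
  obtains A :: "'c \<Rightarrow> 'a \<Rightarrow> 'b \<Rightarrow> nat" where
    "\<And>c i k. A c i k \<le> 1"
    "\<And>i k. i \<in> I \<Longrightarrow> k \<in> K \<Longrightarrow> d i k + (\<Sum>c\<in>C. A c i k) = l"
    "\<And>c i. c \<in> C \<Longrightarrow> i \<in> I \<Longrightarrow> (\<Sum>k\<in>K. A c i k) \<le> l"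
    "\<And>c k. c \<in> C \<Longrightarrow> k \<in> K \<Longrightarrow> (\<Sum>i\<in>I. A c i k) \<le> l"
    "\<And>c i. c \<in> C \<Longrightarrow> i \<in> I \<Longrightarrow> l * card K = (\<Sum>k\<in>K. d i k) + l * card C \<Longrightarrow>
      (\<Sum>k\<in>K. A c i k) = l"
proof -
  let ?b = "\<lambda>i k. l - d i k"
  have rs: "(\<Sum>k\<in>K. d i k) + (\<Sum>k\<in>K. ?b i k) = l * card K" if "i \<in> I" for i
    using d[OF that] by (simp add: sum.distrib[symmetric])
  have cs: "(\<Sum>i\<in>I. d i k) + (\<Sum>i\<in>I. ?b i k) = l * card I" if "k \<in> K" for k
    using d[OF _ that] by (simp add: sum.distrib[symmetric])
  have ent: "?b i k \<le> card C" for i k using l by linarith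
  have row': "(\<Sum>k\<in>K. ?b i k) \<le> l * card C" if "i \<in> I" for i
    using rs[OF that] row[OF that] by linarith
  have col': "(\<Sum>i\<in>I. ?b i k) \<le> l * card C" if "k \<in> K" for k
    using cs[OF that] col[OF that] by linarith
  obtain A :: "'c \<Rightarrow> 'a \<Rightarrow> 'b \<Rightarrow> nat" where
    A1: "\<And>c i k. A c i k \<le> 1"
    and A2: "\<And>i k. i \<in> I \<Longrightarrow> k \<in> K \<Longrightarrow> (\<Sum>c\<in>C. A c i k) = ?b i k"
    and A3: "\<And>c i. c \<in> C \<Longrightarrow> i \<in> I \<Longrightarrow> (\<Sum>k\<in>K. A c i k) \<le> l"
    and A4: "\<And>c k. c \<in> C \<Longrightarrow> k \<in> K \<Longrightarrow> (\<Sum>i\<in>I. A c i k) \<le> l"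
    using balanced_colouring[of I K C ?b l, OF fin ent row' col'] by metis
  have "(\<Sum>k\<in>K. A c i k) = l"
    if c: "c \<in> C" and i: "i \<in> I" and eq: "l * card K = (\<Sum>k\<in>K. d i k) + l * card C" for c i
  proof (rule ccontr)
    assume "(\<Sum>k\<in>K. A c i k) \<noteq> l"
    then have "(\<Sum>c\<in>C. \<Sum>k\<in>K. A c i k) < (\<Sum>c\<in>C. l)"
      using c A3[OF _ i] fin(3) by (intro sum_strict_mono_ex1) (auto simp: less_le)
    moreover have "(\<Sum>c\<in>C. \<Sum>k\<in>K. A c i k) = (\<Sum>k\<in>K. ?b i k)"
      using A2[OF i] by (subst sum.swap) simp
    ultimately show False using rs[OF i] eq by (simp add: mult.commute)
  qed
  then show ?thesis
    using A1 A2 A3 A4 d by (intro that[of A]) auto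
qed

section \<open>The extension theorem\<close>

theorem corollary1p5:
  fixes n r l :: nat and M :: mset_array
  assumes "n > 0" and "r > 0" and "l > 0"
    and "n \<ge> 2 * r" and "2 * r \<ge> 2 * l"
    and "partial_latin_square l r M" and "simple_array r M"
  shows "\<exists>N. latin_square l n N \<and> simple_array n N \<and> extended_to r M N"
proof -
  let ?R = "{1..r}" and ?C = "{r<..n}" and ?S = "{1..n}"
  have rn: "r \<le> n" and lC: "l \<le> card ?C" and rC: "r \<le> card ?C"
    and card_S: "card ?S = r + card ?C" and card_R: "card ?R = r"
    using assms by auto
  note One_nat_def[simp del] card_greaterThanAtMost[simp del] card_atLeastAtMost[simp del]
  have bound: "l * r \<le> l * card ?C" using rC by (rule mult_le_mono2)
  have split: "(\<Sum>x\<in>?S. f x) = (\<Sum>x\<in>?R. f x) + (\<Sum>x\<in>?C. f x)" for f :: "nat \<Rightarrow> nat"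
  proof -
    have "?S = ?R \<union> ?C" using rn by auto
    then show ?thesis by (simp only:) (rule sum.union_disjoint, auto)
  qed
  have split_if: "(\<Sum>x\<in>?S. if x \<le> r then f x else g x) = (\<Sum>x\<in>?R. f x) + (\<Sum>x\<in>?C. g x)"
    for f g :: "nat \<Rightarrow> nat"
    unfolding split by (intro arg_cong2[where f = "(+)"] sum.cong) auto
  have sz: "(\<Sum>k\<in>?R. count (M i j) k) = size (M i j)"
    and sub: "set_mset (M i j) \<subseteq> ?R" and sl: "size (M i j) \<le> l"
    and simp1: "count (M i j) k \<le> 1"
    if "i \<in> ?R" "j \<in> ?R" for i j k
  proof -
    show s: "set_mset (M i j) \<subseteq> ?R" and "size (M i j) \<le> l" and "count (M i j) k \<le> 1"
      using assms(6,7) that by (auto simp: partial_latin_square_def simple_array_def)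
    show "(\<Sum>k\<in>?R. count (M i j) k) = size (M i j)"
      unfolding size_multiset_overloaded_eq using s
      by (intro sum.mono_neutral_right) (auto simp: not_in_iff)
  qed
  have rowM: "(\<Sum>j\<in>?R. count (M i j) k) \<le> l" if "i \<in> ?R" "k \<in> ?R" for i k
    using assms(6) that unfolding partial_latin_square_def row_col_bounded_def by blast
  have colM: "(\<Sum>i\<in>?R. count (M i j) k) \<le> l" if "j \<in> ?R" "k \<in> ?R" for j k
    using assms(6) that unfolding partial_latin_square_def row_col_bounded_def by blast

  \<comment> \<open>The cells of \<open>M\<close> are filled up with symbols outside \<open>[r]\<close>; \<open>A k\<close> marks the cells that
    receive the symbol \<open>k\<close>.\<close>
  obtain A :: "nat \<Rightarrow> nat \<Rightarrow> nat \<Rightarrow> nat" where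
    A01: "\<And>k i j. A k i j \<le> 1"
    and A_cell: "\<And>i j. i \<in> ?R \<Longrightarrow> j \<in> ?R \<Longrightarrow> size (M i j) + (\<Sum>k\<in>?C. A k i j) = l"
    and A_row: "\<And>k i. k \<in> ?C \<Longrightarrow> i \<in> ?R \<Longrightarrow> (\<Sum>j\<in>?R. A k i j) \<le> l"
    and A_col: "\<And>k j. k \<in> ?C \<Longrightarrow> j \<in> ?R \<Longrightarrow> (\<Sum>i\<in>?R. A k i j) \<le> l"
  proof (rule fill_lines[of ?R ?R ?C l "\<lambda>i j. size (M i j)"])
    show "l * card ?R \<le> (\<Sum>j\<in>?R. size (M i j)) + l * card ?C" for i
      unfolding card_R by (rule trans_le_add2[OF bound])
    show "l * card ?R \<le> (\<Sum>i\<in>?R. size (M i j)) + l * card ?C" for j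
      unfolding card_R by (rule trans_le_add2[OF bound])
  qed (use lC sl in auto)
  define T1 where "T1 i j k = (if k \<le> r then count (M i j) k else A k i j)" for i j k
  have T1_01: "T1 i j k \<le> 1" if "i \<in> ?R" "j \<in> ?R" for i j k
    using simp1[OF that] A01 by (simp add: T1_def)
  have T1_cell: "(\<Sum>k\<in>?S. T1 i j k) = l" if "i \<in> ?R" "j \<in> ?R" for i j
    using A_cell[OF that] sz[OF that] by (simp add: T1_def split_if)
  have T1_row: "(\<Sum>j\<in>?R. T1 i j k) \<le> l" if "i \<in> ?R" "k \<in> ?S" for i k
    using that rowM[of i k] A_row[of k i] by (cases "k \<le> r") (auto simp: T1_def)
  have T1_col: "(\<Sum>i\<in>?R. T1 i j k) \<le> l" if "j \<in> ?R" "k \<in> ?S" for j k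
    using that colM[of j k] A_col[of k j] by (cases "k \<le> r") (auto simp: T1_def)

  \<comment> \<open>The columns outside \<open>[r]\<close> supply what each symbol lacks in the first \<open>r\<close> rows. As the cells
    present so far hold \<open>l\<close> symbols each, the deficits of a row leave no slack, and so the new cells
    hold exactly \<open>l\<close> symbols as well.\<close>
  have row_total: "l * card ?S = (\<Sum>k\<in>?S. \<Sum>j\<in>?R. T1 i j k) + l * card ?C" if "i \<in> ?R" for i
    using T1_cell[OF that] by (subst sum.swap) (simp add: card_R card_S algebra_simps)
  obtain B :: "nat \<Rightarrow> nat \<Rightarrow> nat \<Rightarrow> nat" where
    B01: "\<And>j i k. B j i k \<le> 1"
    and B_row: "\<And>i k. i \<in> ?R \<Longrightarrow> k \<in> ?S \<Longrightarrow> (\<Sum>j\<in>?R. T1 i j k) + (\<Sum>j\<in>?C. B j i k) = l"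
    and B_col: "\<And>j k. j \<in> ?C \<Longrightarrow> k \<in> ?S \<Longrightarrow> (\<Sum>i\<in>?R. B j i k) \<le> l"
    and B_cell: "\<And>j i. j \<in> ?C \<Longrightarrow> i \<in> ?R \<Longrightarrow> (\<Sum>k\<in>?S. B j i k) = l"
  proof (rule fill_lines[of ?R ?S ?C l "\<lambda>i k. \<Sum>j\<in>?R. T1 i j k"])
    show "l * card ?S \<le> (\<Sum>k\<in>?S. \<Sum>j\<in>?R. T1 i j k) + l * card ?C" if "i \<in> ?R" for i
      using row_total[OF that] by simp
    show "l * card ?R \<le> (\<Sum>i\<in>?R. \<Sum>j\<in>?R. T1 i j k) + l * card ?C" for k
      unfolding card_R by (rule trans_le_add2[OF bound])
  qed (use lC T1_row row_total in auto)
  define T2 where "T2 i j k = (if j \<le> r then T1 i j k else B j i k)" for i j k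
  have T2_01: "T2 i j k \<le> 1" if "i \<in> ?R" "j \<in> ?S" for i j k
    using that T1_01 B01 by (simp add: T2_def)
  have T2_cell: "(\<Sum>k\<in>?S. T2 i j k) = l" if "i \<in> ?R" "j \<in> ?S" for i j
    using that T1_cell[of i j] B_cell[of j i] by (cases "j \<le> r") (auto simp: T2_def)
  have T2_row: "(\<Sum>j\<in>?S. T2 i j k) = l" if "i \<in> ?R" "k \<in> ?S" for i k
    using B_row[OF that] by (simp add: T2_def split_if)
  have T2_col: "(\<Sum>i\<in>?R. T2 i j k) \<le> l" if "j \<in> ?S" "k \<in> ?S" for j k
    using that T1_col[of j k] B_col[of j k] by (cases "j \<le> r") (auto simp: T2_def)

  \<comment> \<open>The rows outside \<open>[r]\<close> supply what each symbol lacks in each column. The first \<open>r\<close> rows are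
    complete, so the deficits add up to \<open>l * (n - r)\<close> for each column and for each symbol.\<close>
  have col_total: "l * card ?S = (\<Sum>k\<in>?S. \<Sum>i\<in>?R. T2 i j k) + l * card ?C" if "j \<in> ?S" for j
    using T2_cell[OF _ that] by (subst sum.swap) (simp add: card_R card_S algebra_simps)
  have symbol_total: "l * card ?S = (\<Sum>j\<in>?S. \<Sum>i\<in>?R. T2 i j k) + l * card ?C" if "k \<in> ?S" for k
    using T2_row[OF _ that] by (subst sum.swap) (simp add: card_R card_S algebra_simps)
  obtain D :: "nat \<Rightarrow> nat \<Rightarrow> nat \<Rightarrow> nat" where
    D01: "\<And>i j k. D i j k \<le> 1"
    and D_col: "\<And>j k. j \<in> ?S \<Longrightarrow> k \<in> ?S \<Longrightarrow> (\<Sum>i\<in>?R. T2 i j k) + (\<Sum>i\<in>?C. D i j k) = l"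
    and D_row: "\<And>i k. i \<in> ?C \<Longrightarrow> k \<in> ?S \<Longrightarrow> (\<Sum>j\<in>?S. D i j k) \<le> l"
    and D_cell: "\<And>i j. i \<in> ?C \<Longrightarrow> j \<in> ?S \<Longrightarrow> (\<Sum>k\<in>?S. D i j k) = l"
  proof (rule fill_lines[of ?S ?S ?C l "\<lambda>j k. \<Sum>i\<in>?R. T2 i j k"])
    show "l * card ?S \<le> (\<Sum>k\<in>?S. \<Sum>i\<in>?R. T2 i j k) + l * card ?C" if "j \<in> ?S" for j
      using col_total[OF that] by simp
    show "l * card ?S \<le> (\<Sum>j\<in>?S. \<Sum>i\<in>?R. T2 i j k) + l * card ?C" if "k \<in> ?S" for k
      using symbol_total[OF that] by simp
  qed (use lC T2_col col_total in auto)
  define T where "T i j k = (if i \<le> r then T2 i j k else D i j k)" for i j k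
  have T_01: "T i j k \<le> 1" if "i \<in> ?S" "j \<in> ?S" for i j k
    using that T2_01 D01 by (simp add: T_def)
  have T_cell: "(\<Sum>k\<in>?S. T i j k) = l" if "i \<in> ?S" "j \<in> ?S" for i j
    using that T2_cell[of i j] D_cell[of i j] by (cases "i \<le> r") (auto simp: T_def)
  have T_row: "(\<Sum>j\<in>?S. T i j k) \<le> l" if "i \<in> ?S" "k \<in> ?S" for i k
    using that T2_row[of i k] D_row[of i k] by (cases "i \<le> r") (auto simp: T_def)
  have T_col: "(\<Sum>i\<in>?S. T i j k) = l" if "j \<in> ?S" "k \<in> ?S" for j k
    using D_col[OF that] by (simp add: T_def split_if)

  define N where "N i j = mset_set {k \<in> ?S. T i j k = 1}" for i j
  have count_N: "count (N i j) k = (if k \<in> ?S then T i j k else 0)" if "i \<in> ?S" "j \<in> ?S" for i j k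
    using T_01[OF that, of k] by (auto simp: N_def count_mset_set')
  have set_N: "set_mset (N i j) \<subseteq> ?S" for i j by (auto simp: N_def)
  have size_N: "size (N i j) = l" if "i \<in> ?S" "j \<in> ?S" for i j
  proof -
    have "size (N i j) = (\<Sum>k\<in>?S. count (N i j) k)"
      unfolding size_multiset_overloaded_eq using set_N
      by (intro sum.mono_neutral_left) (auto simp: not_in_iff)
    then show ?thesis using T_cell[OF that] count_N[OF that] by simp
  qed
  have "latin_square l n N"
    using set_N size_N T_row T_col
    by (auto simp: latin_square_def row_col_bounded_def count_N)
  moreover have "simple_array n N"
    using T_01 by (auto simp: simple_array_def count_N)
  moreover have "extended_to r M N"
    unfolding extended_to_def
  proof (intro ballI mset_subset_eqI)
    fix i j k assume ij: "i \<in> ?R" "j \<in> ?R"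
    show "count (M i j) k \<le> count (N i j) k"
    proof (cases "k \<in> ?R")
      case True
      then show ?thesis using ij rn by (simp add: count_N T_def T2_def T1_def)
    next
      case False
      then have "count (M i j) k = 0" using sub[OF ij] by (auto simp: not_in_iff[symmetric])
      then show ?thesis by simp
    qed
  qed
  ultimately show ?thesis by blast
qed

end
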